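(* Let $M$ be a matroid on a finite set $V$ of vertices with rank function $\rho$. For each $v \in V$ let $F_v$ be a convex set in $\mathbb{R}^d$. Suppose that for each set $V' \in M$ (i.e., each independent set) there exists an ellipsoid of volume one contained in $\bigcap_{v \in V'} F_v$. Then there exists a set $\tau \subset V$ such that $\rho(V \setminus \tau) \le d(d+3)/2 - 1$ and there exists an ellipsoid of volume one contained in $\bigcap_{v \in \tau} F_v$.
   Context: A matroid $M$ on a finite set $V$ is a family of subsets of $V$ (called independent sets) such that $\emptyset \in M$; if $A \subset B$ and $B \in M$ then $A \in M$; and if $A, B \in M$ with $|B| > |A|$ there exists $a \in B \setminus A$ with $A \cup \{a\} \in M$. For $V' \subset V$, the rank $\rho(V')$ is the cardinality of the largest independent set contained in $V'$. An ellipsoid in $\mathbb{R}^d$ is the image of the Euclidean unit ball under an invertible affine map. An intersection over the empty index set is $\mathbb{R}^d$. *)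

theory Defs
  imports "HOL-Analysis.Analysis"
begin

definition matroid_on :: "'v set \<Rightarrow> 'v set set \<Rightarrow> bool" where
  "matroid_on V M \<longleftrightarrow>
     finite V \<and> M \<subseteq> Pow V \<and> {} \<in> M \<and>
     (\<forall>A B. A \<subseteq> B \<and> B \<in> M \<longrightarrow> A \<in> M) \<and>
     (\<forall>A\<in>M. \<forall>B\<in>M. card A < card B \<longrightarrow> (\<exists>a\<in>B - A. A \<union> {a} \<in> M))"

definition matroid_rank :: "'v set set \<Rightarrow> 'v set \<Rightarrow> nat" where
  "matroid_rank M V' = Max (card ` {A \<in> M. A \<subseteq> V'})"

definition ellipsoid :: "(real ^ 'n) set \<Rightarrow> bool" where
  "ellipsoid E \<longleftrightarrow>
     (\<exists>(A :: real ^ 'n ^ 'n) c. invertible A \<and> E = (\<lambda>x. A *v x + c) ` cball 0 1)"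

end

theory Submission
  imports Defs "HOL-Library.Uprod"
begin

text \<open>Every ellipsoid is the image of the unit ball under \<open>x \<mapsto> L x + b\<close> with \<open>L\<close> lower triangular
  with positive diagonal, so ellipsoids are parametrized by pairs \<open>(L, b)\<close> in a space of dimension
  \<open>D = d(d+3)/2\<close>. The parameters of ellipsoids contained in a convex set form a convex set, and by
  concavity of the logarithm so do the parameters of ellipsoids of volume at least one. Among the
  independent sets choose one whose parameter of least norm is as large as possible. Helly's theorem
  in dimension \<open>D\<close>, applied to its members, the volume constraint and an open ball around the origin,
  yields at most \<open>D - 1\<close> members with the same point \<open>p\<close> of least norm: the ball and the volume
  constraint are both among the \<open>D + 1\<close> sets with empty intersection, since shrinking an ellipsoid
  to its centre decreases the norm. By uniqueness of the point of least norm, every element that can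
  be added to these members while keeping them independent has its set satisfied by \<open>p\<close>, so by the
  exchange axiom the elements not satisfied by \<open>p\<close> have rank at most \<open>D - 1\<close>.\<close>

section \<open>Closest points and matroids\<close>

lemma Helly_two_distinguished:
  fixes G :: "'v \<Rightarrow> 'a::euclidean_space set"
  assumes fin: "finite \<sigma>"
    and cG: "\<And>v. v \<in> \<sigma> \<Longrightarrow> convex (G v)" and cK: "convex K" and cB: "convex B"
    and empty: "K \<inter> B \<inter> (\<Inter>v\<in>\<sigma>. G v) = {}"
    and K: "K \<inter> (\<Inter>v\<in>\<sigma>. G v) \<noteq> {}" and B: "B \<inter> (\<Inter>v\<in>\<sigma>. G v) \<noteq> {}"
  obtains \<sigma>' where "\<sigma>' \<subseteq> \<sigma>" "card \<sigma>' < DIM('a)" "K \<inter> B \<inter> (\<Inter>v\<in>\<sigma>'. G v) = {}"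
proof -
  define P where "P s \<longleftrightarrow> s \<subseteq> \<sigma> \<and> K \<inter> B \<inter> (\<Inter>v\<in>s. G v) = {}" for s
  have "P \<sigma>" using empty by (simp add: P_def)
  then obtain s where s: "P s" and min: "\<And>t. P t \<Longrightarrow> card s \<le> card t"
    using ex_has_least_nat[of P \<sigma> card] by blast
  have ss: "s \<subseteq> \<sigma>" and se: "K \<inter> B \<inter> (\<Inter>v\<in>s. G v) = {}"
    using s by (auto simp: P_def)
  have fs: "finite s" using ss fin finite_subset by blast
  have drop: "K \<inter> B \<inter> (\<Inter>w\<in>s - {v}. G w) \<noteq> {}" if "v \<in> s" for v
  proof
    assume "K \<inter> B \<inter> (\<Inter>w\<in>s - {v}. G w) = {}"
    with ss have "P (s - {v})" by (auto simp: P_def)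
    then have "card s \<le> card (s - {v})" by (rule min)
    then show False using that fs by (meson card_Diff1_less leD)
  qed
  have Ks: "K \<inter> (\<Inter>v\<in>s. G v) \<noteq> {}" and Bs: "B \<inter> (\<Inter>v\<in>s. G v) \<noteq> {}"
    using K B ss by blast+
  have "card s < DIM('a)"
  proof (rule ccontr)
    assume "\<not> card s < DIM('a)"
    then have big: "DIM('a) \<le> card s" by simp
    \<comment> \<open>\<open>Helly\<close> counts sets rather than indices, so the members have to
      be distinct; a repeated one could be dropped.\<close>
    have inj: "inj_on G s"
    proof (rule inj_onI, rule ccontr)
      fix v w assume vw: "v \<in> s" "w \<in> s" "G v = G w" "v \<noteq> w"
      then have "(\<Inter>u\<in>s - {v}. G u) = (\<Inter>u\<in>s. G u)" by blast
      with drop[OF vw(1)] se show False by simp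
    qed
    have KG: "K \<notin> G ` s" and BG: "B \<notin> G ` s" and KB: "K \<noteq> B"
      using Bs Ks se by blast+
    define f where "f = insert K (insert B (G ` s))"
    have cf: "card f = card s + 2"
      using KG BG KB fs inj by (simp add: f_def card_image)
    have "\<Inter>f \<noteq> {}"
    proof (rule Helly)
      show "DIM('a) + 1 \<le> card f" using cf big by simp
      show "\<forall>S\<in>f. convex S" using cG cK cB ss by (auto simp: f_def)
      fix t assume t: "t \<subseteq> f" "card t = DIM('a) + 1"
      then have "t \<noteq> f" using cf big by auto
      then obtain S where S: "S \<in> f" "S \<notin> t" using t by blast
      consider "S = K" | "S = B" | v where "v \<in> s" "S = G v"
        using S by (auto simp: f_def)
      then show "\<Inter>t \<noteq> {}"
      proof cases
        case 1
        then have "B \<inter> (\<Inter>v\<in>s. G v) \<subseteq> \<Inter>t" using S t by (auto simp: f_def)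
        then show ?thesis using Bs by blast
      next
        case 2
        then have "K \<inter> (\<Inter>v\<in>s. G v) \<subseteq> \<Inter>t" using S t by (auto simp: f_def)
        then show ?thesis using Ks by blast
      next
        case 3
        have "K \<inter> B \<inter> (\<Inter>w\<in>s - {v}. G w) \<subseteq> \<Inter>t"
        proof
          fix x assume x: "x \<in> K \<inter> B \<inter> (\<Inter>w\<in>s - {v}. G w)"
          show "x \<in> \<Inter>t"
          proof
            fix T assume "T \<in> t"
            then have "T \<in> f" "T \<noteq> G v" using t S 3 by auto
            then show "x \<in> T" using x by (auto simp: f_def)
          qed
        qed
        then show ?thesis using drop[OF 3(1)] by blast
      qed
    qed
    then show False using se by (auto simp: f_def)
  qed
  with ss se show ?thesis using that by blast
qed

text \<open>A larger independent subset of \<open>W\<close> would extend \<open>s\<close> by the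
  exchange axiom. In the application \<open>s\<close> is disjoint from \<open>W\<close>.\<close>

lemma matroid_rank_le_card:
  assumes M: "matroid_on V M" and s: "s \<in> M"
    and noext: "\<And>a. a \<in> W \<Longrightarrow> a \<notin> s \<Longrightarrow> insert a s \<notin> M"
  shows "matroid_rank M W \<le> card s"
proof -
  have fM: "finite M" and em: "{} \<in> M"
    using M finite_subset[of M "Pow V"] by (auto simp: matroid_on_def)
  have "card A \<le> card s" if A: "A \<in> M" "A \<subseteq> W" for A
  proof (rule ccontr)
    assume "\<not> card A \<le> card s"
    then obtain a where "a \<in> A - s" "s \<union> {a} \<in> M"
      using M A s unfolding matroid_on_def by (meson not_le)
    then show False using noext[of a] A by auto
  qed
  then show ?thesis
    unfolding matroid_rank_def using fM em by (subst Max_le_iff) auto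
qed

text \<open>The map \<open>\<pi>\<close> ensures that Helly's theorem cannot ignore \<open>K\<close>; this saves one element in the
  bound.\<close>

lemma matroid_convex_intersection:
  fixes G :: "'v \<Rightarrow> 'a::euclidean_space set" and \<pi> :: "'a \<Rightarrow> 'a"
  assumes M: "matroid_on V M"
    and cG: "\<And>v. v \<in> V \<Longrightarrow> convex (G v)" and clG: "\<And>v. v \<in> V \<Longrightarrow> closed (G v)"
    and cK: "convex K" and clK: "closed K"
    and ne: "\<And>\<sigma>. \<sigma> \<in> M \<Longrightarrow> K \<inter> (\<Inter>v\<in>\<sigma>. G v) \<noteq> {}"
    and \<pi>G: "\<And>v x. v \<in> V \<Longrightarrow> x \<in> G v \<Longrightarrow> \<pi> x \<in> G v"
    and \<pi>K: "\<And>x. x \<in> K \<Longrightarrow> norm (\<pi> x) < norm x"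
  obtains \<tau> where "\<tau> \<subseteq> V" "matroid_rank M (V - \<tau>) < DIM('a)" "K \<inter> (\<Inter>v\<in>\<tau>. G v) \<noteq> {}"
proof -
  define I where "I \<sigma> = K \<inter> (\<Inter>v\<in>\<sigma>. G v)" for \<sigma>
  define q where "q \<sigma> = closest_point (I \<sigma>) 0" for \<sigma>
  have MV: "\<sigma> \<subseteq> V" if "\<sigma> \<in> M" for \<sigma> using M that by (auto simp: matroid_on_def)
  have fM: "finite M" and em: "{} \<in> M" and fV: "finite V"
    using M finite_subset[of M "Pow V"] by (auto simp: matroid_on_def)
  have cvI: "convex (I \<sigma>)" and clI: "closed (I \<sigma>)" and neI: "I \<sigma> \<noteq> {}" if "\<sigma> \<in> M" for \<sigma>
  proof -
    show "convex (I \<sigma>)" unfolding I_def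
      by (intro convex_Int convex_INT cK cG) (use MV[OF that] in blast)
    show "closed (I \<sigma>)" unfolding I_def
      by (intro closed_Int closed_INT clK ballI clG) (use MV[OF that] in blast)
    show "I \<sigma> \<noteq> {}" using ne[OF that] by (simp add: I_def)
  qed
  have qI: "q \<sigma> \<in> I \<sigma>" if "\<sigma> \<in> M" for \<sigma>
    unfolding q_def by (intro closest_point_in_set clI neI that)
  have qle: "norm (q \<sigma>) \<le> norm x" if "\<sigma> \<in> M" "x \<in> I \<sigma>" for \<sigma> x
    using closest_point_le[OF clI, OF that, of 0] by (simp add: q_def)
  have quniq: "x = q \<sigma>" if "\<sigma> \<in> M" "x \<in> I \<sigma>" "norm x \<le> norm (q \<sigma>)" for \<sigma> x
    unfolding q_def
  proof (rule closest_point_unique[OF cvI clI])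
    show "\<forall>z\<in>I \<sigma>. dist 0 x \<le> dist 0 z" using qle that by fastforce
  qed (use that in auto)
  obtain \<sigma> where \<sigma>: "\<sigma> \<in> M" and "norm (q \<sigma>) = (MAX t\<in>M. norm (q t))"
    by (rule obtains_MAX[OF fM, of "\<lambda>t. norm (q t)"]) (use em in auto)
  then have \<sigma>max: "norm (q t) \<le> norm (q \<sigma>)" if "t \<in> M" for t
    using that fM by simp
  define p where "p = q \<sigma>"
  have pI: "p \<in> I \<sigma>" using qI \<sigma> by (simp add: p_def)
  obtain s where s: "s \<subseteq> \<sigma>" "card s < DIM('a)"
    and se: "K \<inter> ball 0 (norm p) \<inter> (\<Inter>v\<in>s. G v) = {}"
  proof (rule Helly_two_distinguished[of \<sigma> G K "ball 0 (norm p)"])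
    show "finite \<sigma>" using MV[OF \<sigma>] fV finite_subset by blast
    show "convex (G v)" if "v \<in> \<sigma>" for v using that MV[OF \<sigma>] cG by blast
    show "K \<inter> ball 0 (norm p) \<inter> (\<Inter>v\<in>\<sigma>. G v) = {}"
      using qle[OF \<sigma>] by (fastforce simp: p_def I_def)
    show "K \<inter> (\<Inter>v\<in>\<sigma>. G v) \<noteq> {}" using ne \<sigma> by blast
    \<comment> \<open>Strict decrease of the norm under \<open>\<pi>\<close> on \<open>K\<close>
      puts \<open>\<pi> p\<close> into the open ball; this point shows that \<open>K\<close> cannot
      be dropped.\<close>
    have "\<pi> p \<in> ball 0 (norm p) \<inter> (\<Inter>v\<in>\<sigma>. G v)"
      using pI \<pi>G \<pi>K MV[OF \<sigma>] by (auto simp: I_def)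
    then show "ball 0 (norm p) \<inter> (\<Inter>v\<in>\<sigma>. G v) \<noteq> {}" by blast
  qed (use cK in auto)
  have sM: "s \<in> M" using M \<sigma> s unfolding matroid_on_def by blast
  have ple: "norm p \<le> norm x" if "x \<in> I s" for x
    using se that by (fastforce simp: I_def)
  have ps: "p = q s"
  proof (rule quniq[OF sM])
    show "p \<in> I s" using pI s by (auto simp: I_def)
    show "norm p \<le> norm (q s)" using ple qI sM by blast
  qed
  define \<tau> where "\<tau> = {v \<in> V. p \<in> G v}"
  have "matroid_rank M (V - \<tau>) \<le> card s"
  proof (rule matroid_rank_le_card[OF M sM], rule notI)
    fix a assume a: "a \<in> V - \<tau>" and ins: "insert a s \<in> M"
    \<comment> \<open>Adding \<open>a\<close> shrinks \<open>I s\<close>, while maximality of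
      \<open>\<sigma>\<close> keeps the least norm at most \<open>norm p\<close>; uniqueness forces
      the same nearest point.\<close>
    have "q (insert a s) = p"
      unfolding ps
    proof (rule quniq[OF sM])
      show "q (insert a s) \<in> I s" using qI[OF ins] by (auto simp: I_def)
      show "norm (q (insert a s)) \<le> norm (q s)" using \<sigma>max[OF ins] ps p_def by simp
    qed
    then have "p \<in> G a" using qI[OF ins] by (auto simp: I_def)
    then show False using a by (auto simp: \<tau>_def)
  qed
  then have "matroid_rank M (V - \<tau>) < DIM('a)" using s(2) by simp
  moreover have "p \<in> K \<inter> (\<Inter>v\<in>\<tau>. G v)" using pI by (auto simp: I_def \<tau>_def)
  moreover have "\<tau> \<subseteq> V" by (auto simp: \<tau>_def)
  ultimately show ?thesis by (intro that[of \<tau>]) blast+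
qed

section \<open>Triangular matrices\<close>

text \<open>The index type \<open>'n\<close> carries no order, so triangularity is expressed through an injective
  ranking \<open>r\<close> of the indices.\<close>

lemma det_triangular:
  fixes A :: "real ^ 'n ^ 'n" and r :: "'n \<Rightarrow> nat"
  assumes r: "inj r" and A: "\<And>i j. r i < r j \<Longrightarrow> A $ i $ j = 0"
  shows "det A = (\<Prod>i\<in>UNIV. A $ i $ i)"
proof -
  let ?t = "\<lambda>p. of_int (sign p) * (\<Prod>i\<in>UNIV. A $ i $ p i)"
  have "?t p = 0" if p: "p permutes UNIV" "p \<noteq> id" for p
  proof -
    \<comment> \<open>If \<open>p\<close> never raised the rank, equality of the two sums of ranks
      would make it preserve every rank, hence be the identity.\<close>
    have "\<exists>i. r i < r (p i)"
    proof (rule ccontr)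
      assume "\<nexists>i. r i < r (p i)"
      then have le: "\<And>i. r (p i) \<le> r i" by (meson not_le)
      have "(\<Sum>i\<in>UNIV. r (p i)) = (\<Sum>i\<in>UNIV. r i)"
        using sum.permute[OF p(1), of r] by (simp add: o_def)
      then have "r (p i) = r i" for i
        using sum_mono_inv[of "\<lambda>i. r (p i)" UNIV r i] le by auto
      then have "p = id" using r by (auto simp: inj_def fun_eq_iff)
      then show False using p by simp
    qed
    then obtain i where "A $ i $ p i = 0" using A by blast
    then have "(\<Prod>i\<in>UNIV. A $ i $ p i) = 0" by (auto intro: prod_zero)
    then show ?thesis by simp
  qed
  then have "det A = sum ?t {id}"
    unfolding det_def by (intro sum.mono_neutral_right) (auto simp: permutes_id finite_permutations)
  then show ?thesis by (simp add: sign_id)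
qed

text \<open>Gram--Schmidt applied to the rows of \<open>A\<close>: the \<open>j\<close>-th column \<open>Q j\<close> of the orthogonal
  factor is the normalized component of the row \<open>A $ j\<close> orthogonal to the rows of smaller
  rank.\<close>

lemma triangular_orthogonal_decomposition:
  fixes A :: "real ^ 'n ^ 'n" and r :: "'n \<Rightarrow> nat"
  assumes r: "inj r" and A: "invertible A"
  obtains Q where "orthogonal_matrix Q"
    "\<And>i j. r i < r j \<Longrightarrow> (A ** Q) $ i $ j = 0" "\<And>i. (A ** Q) $ i $ i > 0"
proof -
  obtain A' where A': "A ** A' = mat 1"
    using A by (auto simp: invertible_def)
  define S where "S j = span ((($) A) ` {i. r i < r j})" for j
  have "\<exists>q. norm q = 1 \<and> (\<forall>x\<in>S j. orthogonal q x) \<and> q \<in> span ((($) A) ` {i. r i \<le> r j}) \<and> A $ j \<bullet> q > 0" for j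
  proof -
    obtain y z where yz: "y \<in> S j" "\<And>w. w \<in> S j \<Longrightarrow> orthogonal z w" "A $ j = y + z"
      using orthogonal_subspace_decomp_exists[of "(($) A) ` {i. r i < r j}" "A $ j"]
      unfolding S_def by metis
    have "A $ j \<notin> S j"
    proof
      \<comment> \<open>The columns of the inverse are dual to the rows of \<open>A\<close>: column
        \<open>j\<close> is orthogonal to all rows but row \<open>j\<close>, which is thus not in
        the span \<open>S j\<close>.\<close>
      have dual: "column j A' \<bullet> A $ i = (if i = j then 1 else 0)" for i
        using arg_cong[OF A', of "\<lambda>B. B $ i $ j"]
        by (simp add: matrix_matrix_mult_def mat_def column_def inner_vec_def mult.commute)
      assume "A $ j \<in> S j"
      then have "orthogonal (column j A') (A $ j)"
        unfolding S_def by (rule orthogonal_to_span) (auto simp: orthogonal_def dual)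
      then show False using dual[of j] by (simp add: orthogonal_def)
    qed
    then have z: "z \<noteq> 0" using yz by auto
    have "S j \<subseteq> span ((($) A) ` {i. r i \<le> r j})"
      unfolding S_def by (intro span_mono) auto
    then have "A $ j - y \<in> span ((($) A) ` {i. r i \<le> r j})"
      using yz(1) by (intro span_diff) (auto intro: span_base)
    then have "z \<in> span ((($) A) ` {i. r i \<le> r j})"
      using yz(3) by simp
    moreover have "A $ j \<bullet> z > 0"
      using yz(2)[OF yz(1)] yz(3) z by (simp add: inner_add_left orthogonal_def inner_commute[of y])
    ultimately show ?thesis
      using z yz
      by (intro exI[of _ "z /\<^sub>R norm z"])
         (auto simp: orthogonal_def span_mul)
  qed
  then obtain q where q: "\<And>j. norm (q j) = 1" "\<And>j x. x \<in> S j \<Longrightarrow> orthogonal (q j) x"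
    "\<And>j. q j \<in> span ((($) A) ` {i. r i \<le> r j})" "\<And>j. A $ j \<bullet> q j > 0"
    by metis
  have orth: "q i \<bullet> q j = 0" if "r i < r j" for i j
  proof -
    have "span ((($) A) ` {k. r k \<le> r i}) \<subseteq> S j"
      unfolding S_def using that by (intro span_mono) auto
    then show ?thesis using q(2)[of "q i" j] q(3)[of i] by (auto simp: orthogonal_def inner_commute)
  qed
  define Q where "Q = (\<chi> i j. q j $ i)"
  have col: "column j Q = q j" for j by (simp add: Q_def column_def vec_eq_iff)
  have AQ: "(A ** Q) $ i $ j = A $ i \<bullet> q j" for i j
    by (simp add: Q_def matrix_matrix_mult_def inner_vec_def)
  show ?thesis
  proof
    show "orthogonal_matrix Q"
      unfolding orthogonal_matrix_orthonormal_columns col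
    proof (intro conjI allI impI)
      fix i j :: 'n assume "i \<noteq> j"
      then have "r i < r j \<or> r j < r i" using r by (meson injD linorder_neqE)
      then show "orthogonal (q i) (q j)" using orth[of i j] orth[of j i] by (auto simp: orthogonal_def inner_commute)
    qed (use q in auto)
    show "(A ** Q) $ i $ j = 0" if "r i < r j" for i j
      unfolding AQ using q(2)[of "A $ i" j] that
      by (auto simp: S_def span_base orthogonal_def inner_commute)
    show "(A ** Q) $ i $ i > 0" for i unfolding AQ using q by blast
  qed
qed

lemma orthogonal_image_unit_cball:
  fixes Q :: "real ^ 'n ^ 'n"
  assumes "orthogonal_matrix Q"
  shows "(*v) Q ` cball 0 1 = cball 0 1"
  using assms image_orthogonal_transformation_cball[of "(*v) Q" 0 1]
  by (simp add: orthogonal_transformation_matrix)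

section \<open>Volume of ellipsoids\<close>

text \<open>The library proves this only for index types of class \<open>wellorder\<close>.\<close>

lemma measure_linear_image_cart:
  fixes f :: "real ^ 'n \<Rightarrow> real ^ 'n"
  assumes f: "linear f" and S: "S \<in> lmeasurable"
  shows "measure lebesgue (f ` S) = \<bar>det (matrix f)\<bar> * measure lebesgue S"
proof -
  define P where "P f \<longleftrightarrow> (\<forall>S\<in>lmeasurable. f ` S \<in> lmeasurable \<and>
    measure lebesgue (f ` S) = \<bar>det (matrix f)\<bar> * measure lebesgue S)" for f :: "real ^ 'n \<Rightarrow> real ^ 'n"
  \<comment> \<open>For determinant of absolute value 1 it suffices to preserve the volume of boxes;
    this serves the coordinate swaps and the shears.\<close>
  have boxes: "P f" if "linear f" "\<bar>det (matrix f)\<bar> = 1"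
    "\<And>a b. cbox a b \<noteq> {} \<Longrightarrow> measure lebesgue (f ` cbox a b) = measure lebesgue (cbox a b)" for f
    using measure_linear_sufficient[of f _ 1] that unfolding P_def
    by (metis (no_types, lifting) image_is_empty mult_1)
  have "P f"
    using f
  proof (rule induct_linear_elementary)
    show "P (f \<circ> g)" if "linear f" "linear g" "P f" "P g" for f g
      unfolding P_def image_comp[symmetric] using that
      by (simp add: P_def matrix_compose det_mul abs_mult)
  next
    fix f :: "real ^ 'n \<Rightarrow> real ^ 'n" and i
    assume lin: "linear f" and 0: "\<And>x. f x $ i = 0"
    have "\<not> surj f"
    proof
      assume "surj f"
      then obtain x where "f x = axis i 1" by (metis surjD)
      with 0[of x] show False by (simp add: axis_def)
    qed
    then have ninj: "\<not> inj f" using lin linear_injective_imp_surjective by blast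
    then have "det (matrix f) = 0" using det_nz_iff_inj[OF lin] by blast
    then show "P f"
      using negligible_linear_singular_image[OF lin ninj] by (simp add: P_def negligible_iff_measure)
  next
    fix c :: "'n \<Rightarrow> real"
    have "det (matrix (\<lambda>x :: real ^ 'n. \<chi> i. c i * x $ i)) = prod c UNIV"
      by (subst det_diagonal) (auto simp: matrix_def axis_def)
    then show "P (\<lambda>x. \<chi> i. c i * x $ i)"
      by (simp add: P_def measurable_stretch measure_stretch)
  next
    fix m n :: 'n
    let ?t = "Transposition.transpose m n"
    let ?h = "\<lambda>x :: real ^ 'n. \<chi> i. x $ ?t i"
    have perm: "?t permutes UNIV" by (simp add: permutes_swap_id)
    have lin: "linear ?h" by (rule linearI) (simp_all add: vec_eq_iff)
    have "norm (?h x) = norm x" for x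
      using sum.permute[OF perm, of "\<lambda>i. (x $ i)\<^sup>2"] by (simp add: norm_vec_def L2_set_def o_def)
    then have "orthogonal_transformation ?h"
      using lin by (simp add: orthogonal_transformation)
    then have "\<bar>det (matrix ?h)\<bar> = 1"
      by (rule orthogonal_transformation_det)
    moreover have "measure lebesgue (?h ` cbox a b) = measure lebesgue (cbox a b)"
      if ne: "cbox a b \<noteq> {}" for a b
    proof -
      have inv: "?h (?h x) = x" for x by (simp add: vec_eq_iff)
      have mem: "?h x \<in> cbox (?h a) (?h b)" if "x \<in> cbox a b" for x a b
        using that by (simp add: mem_box_cart)
      have eq: "?h ` cbox a b = cbox (?h a) (?h b)"
      proof
        show "cbox (?h a) (?h b) \<subseteq> ?h ` cbox a b"
        proof
          fix y assume "y \<in> cbox (?h a) (?h b)"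
          then have "?h y \<in> cbox a b" using mem[of y "?h a" "?h b"] by (simp only: inv)
          then show "y \<in> ?h ` cbox a b" by (rule image_eqI[rotated]) (simp only: inv)
        qed
      qed (use mem in blast)
      then have "cbox (?h a) (?h b) \<noteq> {}" using ne by (metis image_is_empty)
      then show ?thesis
        using ne prod.permute[OF perm, of "\<lambda>i. b $ i - a $ i"]
        unfolding eq by (simp add: content_cbox_cart o_def)
    qed
    ultimately show "P ?h" using boxes lin by blast
  next
    fix m n :: 'n assume mn: "m \<noteq> n"
    let ?h = "\<lambda>x :: real ^ 'n. \<chi> i. if i = m then x $ m + x $ n else x $ i"
    have lin: "linear ?h"
      by (rule linearI) (auto simp: vec_eq_iff algebra_simps)
    obtain r0 :: "'n \<Rightarrow> nat" where r0: "inj r0"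
      using finite_imp_inj_to_nat_seg[of "UNIV :: 'n set"] by auto
    \<comment> \<open>The only off-diagonal entry of the shear is at \<open>(m, n)\<close>, so a
      ranking with \<open>r n < r m\<close> makes its matrix triangular.\<close>
    obtain r :: "'n \<Rightarrow> nat" where r: "inj r" "r n < r m"
    proof (cases "r0 n < r0 m")
      case False
      moreover have "r0 m \<noteq> r0 n" using r0 mn by (auto dest: injD)
      moreover have "inj (r0 \<circ> Transposition.transpose m n)"
        using r0 by (intro inj_compose) auto
      ultimately show ?thesis
        using that[of "r0 \<circ> Transposition.transpose m n"] by auto
    qed (use r0 that in blast)
    have mat: "matrix ?h $ i $ j = (if i = j then 1 else if i = m \<and> j = n then 1 else 0)" for i j
      using mn by (auto simp: matrix_def axis_def)
    have "det (matrix ?h) = (\<Prod>i\<in>UNIV. matrix ?h $ i $ i)"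
      by (rule det_triangular[OF r(1)]) (use r(2) in \<open>auto simp: mat\<close>)
    also have "\<dots> = 1" by (simp add: mat)
    finally have "\<bar>det (matrix ?h)\<bar> = 1" by simp
    moreover have "measure lebesgue (?h ` cbox a b) = measure lebesgue (cbox a b)"
      if ne: "cbox a b \<noteq> {}" for a b
    proof -
      \<comment> \<open>Translating by \<open>-v\<close> moves the lower bound of the box in
        coordinate \<open>n\<close> to 0, as \<open>measure_shear_interval\<close> requires it to be
        nonnegative.\<close>
      define v :: "real ^ 'n" where "v = axis n (a $ n)"
      have cb: "cbox a b = (+) v ` cbox (a - v) (b - v)"
        using cbox_translation[of v "a - v" "b - v"] by simp
      have "?h ` cbox a b = (+) (?h v) ` ?h ` cbox (a - v) (b - v)"
        unfolding cb image_image by (rule image_cong[OF refl]) (rule linear_add[OF lin])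
      then have "measure lebesgue (?h ` cbox a b) = measure lebesgue (?h ` cbox (a - v) (b - v))"
        by (simp only: measure_translation)
      also have "\<dots> = measure lebesgue (cbox (a - v) (b - v))"
        by (rule measure_shear_interval[OF mn]) (use ne cb in \<open>auto simp: v_def axis_def\<close>)
      also have "\<dots> = measure lebesgue (cbox a b)"
        unfolding cb by (rule measure_translation[symmetric])
      finally show ?thesis .
    qed
    ultimately show "P ?h" using boxes lin by blast
  qed
  then show ?thesis using S by (simp add: P_def)
qed

lemma measure_affine_image_unit_cball:
  fixes A :: "real ^ 'n ^ 'n"
  shows "measure lebesgue ((\<lambda>x. A *v x + c) ` cball 0 1)
    = \<bar>det A\<bar> * measure lebesgue (cball 0 1 :: (real ^ 'n) set)"
proof -
  have "(\<lambda>x. A *v x + c) ` cball 0 1 = (+) c ` ((*v) A ` cball 0 1)"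
    by (auto simp: image_image add.commute)
  then show ?thesis
    using measure_linear_image_cart[OF matrix_vector_mul_linear lmeasurable_cball, of A 0 1]
    by (simp add: measure_translation)
qed

text \<open>Shrink towards the centre \<open>c\<close> by the factor \<open>t\<close> with
  \<open>t ^ CARD('n) = 1 / m\<close>, where \<open>m\<close> is the present volume;
  \<open>m \<ge> 1\<close> gives \<open>t \<le> 1\<close>.\<close>

lemma unit_volume_ellipsoid_in_affine_image:
  fixes A :: "real ^ 'n ^ 'n"
  assumes A: "det A \<noteq> 0" and ge: "1 \<le> \<bar>det A\<bar> * measure lebesgue (cball 0 1 :: (real ^ 'n) set)"
  shows "\<exists>E. ellipsoid E \<and> measure lebesgue E = 1 \<and> E \<subseteq> (\<lambda>x. A *v x + c) ` cball 0 1"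
proof -
  define m where "m = \<bar>det A\<bar> * measure lebesgue (cball 0 1 :: (real ^ 'n) set)"
  define t where "t = root CARD('n) (1 / m)"
  have m: "m \<ge> 1" using ge m_def by simp
  have t: "t > 0" "t \<le> 1" "t ^ CARD('n) = 1 / m"
    using m by (auto simp: t_def)
  have det: "det (t *\<^sub>R A) = t ^ CARD('n) * det A"
    using det_rows_mul[of "\<lambda>_. t" "($) A"]
    by (simp add: scaleR_vec_def vector_scalar_mult_def)
  have "measure lebesgue ((\<lambda>x. (t *\<^sub>R A) *v x + c) ` cball 0 1) = t ^ CARD('n) * m"
    unfolding measure_affine_image_unit_cball det using t(1) by (simp add: abs_mult m_def)
  moreover have "ellipsoid ((\<lambda>x. (t *\<^sub>R A) *v x + c) ` cball 0 1)"
    unfolding ellipsoid_def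
    by (intro exI[of _ "t *\<^sub>R A"] exI[of _ c]) (use det A t(1) in \<open>simp add: invertible_det_nz\<close>)
  moreover have "(\<lambda>x. (t *\<^sub>R A) *v x + c) ` cball 0 1 \<subseteq> (\<lambda>x. A *v x + c) ` cball 0 1"
  proof clarify
    fix x :: "real ^ 'n" assume "x \<in> cball 0 1"
    then have "t *\<^sub>R x \<in> cball 0 1" using t by (auto intro: mult_le_one)
    then show "(t *\<^sub>R A) *v x + c \<in> (\<lambda>x. A *v x + c) ` cball 0 1"
      by (intro image_eqI[of _ _ "t *\<^sub>R x"])
         (auto simp: matrix_vector_mult_scaleR scaleR_matrix_vector_assoc)
  qed
  ultimately show ?thesis using t m by auto
qed

text \<open>Convexity of \<open>exp\<close> yields weighted AM-GM in each factor; multiplying bounds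
  the product below by the weighted geometric mean of the two products, which is at least
  \<open>c\<close>.\<close>

lemma prod_convex_combination_ge:
  fixes a b :: "'n::finite \<Rightarrow> real"
  assumes a: "\<And>i. 0 < a i" "c \<le> prod a UNIV" and b: "\<And>i. 0 < b i" "c \<le> prod b UNIV"
    and c: "0 < c" and uv: "0 \<le> u" "0 \<le> v" "u + v = 1"
  shows "c \<le> (\<Prod>i\<in>UNIV. u * a i + v * b i)"
proof -
  have exp: "exp (u * x + v * y) \<le> u * exp x + v * exp y" for x y :: real
    using exp_convex uv by (auto simp: convex_on_def)
  have "ln c = u * ln c + v * ln c"
    using uv by (metis distrib_right mult_1)
  also have "\<dots> \<le> u * ln (prod a UNIV) + v * ln (prod b UNIV)"
    using a b c uv by (intro add_mono mult_left_mono) auto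
  also have "\<dots> = (\<Sum>i\<in>UNIV. u * ln (a i) + v * ln (b i))"
    using a(1) b(1) by (simp add: ln_prod less_imp_neq[symmetric] sum.distrib sum_distrib_left)
  finally have "c \<le> exp (\<Sum>i\<in>UNIV. u * ln (a i) + v * ln (b i))"
    using c by (simp add: ln_ge_iff[symmetric] ln_le_cancel_iff[symmetric] del: ln_le_cancel_iff)
  also have "\<dots> = (\<Prod>i\<in>UNIV. exp (u * ln (a i) + v * ln (b i)))"
    by (simp add: exp_sum)
  also have "\<dots> \<le> (\<Prod>i\<in>UNIV. u * a i + v * b i)"
    using exp[of "ln (a _)" "ln (b _)"] a b by (intro prod_mono) auto
  finally show ?thesis .
qed

section \<open>Parametrized ellipsoids\<close>

instance uprod :: (finite) finite
  by standard simp

text \<open>A triangular matrix has one free entry for each unordered pair of indices, diagonal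
  pairs included. Indexing by \<open>'n uprod\<close> gives dimension d(d+1)/2 whatever the ranking
  \<open>r\<close>.\<close>

definition triangular_matrix :: "('n \<Rightarrow> nat) \<Rightarrow> real ^ 'n uprod \<Rightarrow> real ^ 'n ^ 'n::finite" where
  "triangular_matrix r x = (\<chi> i j. if r j \<le> r i then x $ Upair i j else 0)"

lemma linear_triangular_matrix: "linear (triangular_matrix r)"
  by (rule linearI) (auto simp: triangular_matrix_def vec_eq_iff)

text \<open>Injectivity of \<open>r\<close> leaves a single ordering of each pair with
  \<open>r j \<le> r i\<close>, so the entry to be read off is well defined.\<close>

lemma triangular_matrix_exists:
  assumes r: "inj r" and L: "\<And>i j. r i < r j \<Longrightarrow> L $ i $ j = 0"
  obtains x where "triangular_matrix r x = L"
proof -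
  define f where "f u = (SOME l. \<exists>i j. u = Upair i j \<and> r j \<le> r i \<and> l = L $ i $ j)" for u
  have "f (Upair i j) = L $ i $ j" if "r j \<le> r i" for i j
    unfolding f_def
    by (rule some_equality) (use that r in \<open>auto dest: injD\<close>)
  then have "triangular_matrix r (\<chi> u. f u) = L"
    using L by (auto simp: triangular_matrix_def vec_eq_iff)
  then show ?thesis using that by blast
qed

lemma det_triangular_matrix:
  "inj r \<Longrightarrow> det (triangular_matrix r x) = (\<Prod>i\<in>UNIV. x $ Upair i i)"
  by (subst det_triangular[of r]) (auto simp: triangular_matrix_def)

definition param_ellipsoid :: "('n \<Rightarrow> nat) \<Rightarrow> (real ^ 'n uprod) \<times> (real ^ 'n) \<Rightarrow> (real ^ 'n::finite) set"
  where "param_ellipsoid r z = (\<lambda>u. triangular_matrix r (fst z) *v u + snd z) ` cball 0 1"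

text \<open>For a fixed point \<open>u\<close> of the unit ball, its image depends linearly on the
  parameter, so a convex combination of parameters sends \<open>u\<close> to the same combination of
  two points of \<open>C\<close>.\<close>

lemma convex_param_ellipsoid_subset:
  fixes C :: "(real ^ 'n) set"
  assumes "convex C"
  shows "convex {z. param_ellipsoid r z \<subseteq> C}"
proof (rule convexI, clarsimp simp: param_ellipsoid_def)
  fix x y :: "real ^ 'n uprod" and b c u :: "real ^ 'n" and s t :: real
  assume h: "(\<lambda>u. triangular_matrix r x *v u + b) ` cball 0 1 \<subseteq> C"
    "(\<lambda>u. triangular_matrix r y *v u + c) ` cball 0 1 \<subseteq> C"
    and st: "0 \<le> s" "0 \<le> t" "s + t = 1" and u: "norm u \<le> 1"
  have "s *\<^sub>R (triangular_matrix r x *v u + b) + t *\<^sub>R (triangular_matrix r y *v u + c) \<in> C"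
    using h u st by (intro convexD[OF assms]) auto
  moreover have "triangular_matrix r (s *\<^sub>R x + t *\<^sub>R y) =
      s *\<^sub>R triangular_matrix r x + t *\<^sub>R triangular_matrix r y"
    by (simp add: linear_add[OF linear_triangular_matrix] linear_cmul[OF linear_triangular_matrix])
  ultimately show "triangular_matrix r (s *\<^sub>R x + t *\<^sub>R y) *v u + (s *\<^sub>R b + t *\<^sub>R c) \<in> C"
    by (simp add: matrix_vector_mult_add_rdistrib scaleR_matrix_vector_assoc scaleR_add_right algebra_simps)
qed

text \<open>An orthogonal \<open>Q\<close> maps the unit ball onto itself, so \<open>A\<close> may
  be replaced by the triangular \<open>A ** Q\<close>.\<close>

lemma ellipsoid_param:
  fixes E :: "(real ^ 'n) set"
  assumes r: "inj r" and E: "ellipsoid E"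
  obtains z where "E = param_ellipsoid r z" "\<And>i. 0 < fst z $ Upair i i"
proof -
  obtain A :: "real ^ 'n ^ 'n" and c
    where A: "invertible A" and EA: "E = (\<lambda>x. A *v x + c) ` cball 0 1"
    using E unfolding ellipsoid_def by blast
  obtain Q where Q: "orthogonal_matrix Q"
    and tri: "\<And>i j. r i < r j \<Longrightarrow> (A ** Q) $ i $ j = 0" and pos: "\<And>i. (A ** Q) $ i $ i > 0"
    using triangular_orthogonal_decomposition[OF r A] by blast
  obtain x where x: "triangular_matrix r x = A ** Q"
    using triangular_matrix_exists[OF r] tri by blast
  have "E = (\<lambda>x. A *v x + c) ` ((*v) Q ` cball 0 1)"
    by (simp add: EA orthogonal_image_unit_cball[OF Q])
  also have "\<dots> = param_ellipsoid r (x, c)"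
    by (simp add: param_ellipsoid_def x image_image matrix_vector_mul_assoc)
  finally show ?thesis
    using that[of "(x, c)"] pos x[symmetric] by (auto simp: triangular_matrix_def)
qed

lemma measure_param_ellipsoid:
  fixes r :: "'n::finite \<Rightarrow> nat"
  assumes "inj r" "\<And>i. 0 < fst z $ Upair i i"
  shows "measure lebesgue (param_ellipsoid r z) =
    (\<Prod>i\<in>UNIV. fst z $ Upair i i) * measure lebesgue (cball 0 1 :: (real ^ 'n) set)"
  using assms
  by (simp add: param_ellipsoid_def measure_affine_image_unit_cball det_triangular_matrix
      abs_of_pos prod_pos)

text \<open>For \<open>\<omega>\<close> the volume of the unit ball, these are the parameters of the ellipsoids of
  volume at least one. The nonstrict sign condition makes the set visibly closed.\<close>

definition big_params :: "real \<Rightarrow> ((real ^ 'n uprod) \<times> (real ^ 'n::finite)) set" where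
  "big_params \<omega> =
    {z. (\<forall>i. 0 \<le> fst z $ Upair i i) \<and> 1 / \<omega> \<le> (\<Prod>i\<in>UNIV. fst z $ Upair i i)}"

text \<open>A vanishing diagonal entry would make the product 0, below
  \<open>1 / \<omega>\<close>.\<close>

lemma big_params_pos:
  assumes "z \<in> big_params \<omega>" "0 < \<omega>"
  shows "0 < fst z $ Upair i i"
proof -
  have "(\<Prod>i\<in>UNIV. fst z $ Upair i i) > 0"
    using assms by (auto simp: big_params_def intro: less_le_trans[of 0 "1 / \<omega>"])
  then have "fst z $ Upair i i \<noteq> 0" by (metis UNIV_I finite_class.finite_UNIV less_irrefl prod_zero_iff)
  then show ?thesis using assms by (auto simp: big_params_def order_less_le)
qed

lemma closed_big_params: "closed (big_params \<omega>)"
  unfolding big_params_def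
  by (intro closed_Collect_conj closed_Collect_all closed_Collect_le continuous_intros)

lemma convex_big_params:
  assumes "0 < \<omega>"
  shows "convex (big_params \<omega>)"
proof (rule convexI)
  fix y z :: "(real ^ 'n uprod) \<times> (real ^ 'n)" and s t :: real
  assume h: "y \<in> big_params \<omega>" "z \<in> big_params \<omega>" and st: "0 \<le> s" "0 \<le> t" "s + t = 1"
  have "1 / \<omega> \<le> (\<Prod>i\<in>UNIV. s * fst y $ Upair i i + t * fst z $ Upair i i)"
    using h assms st big_params_pos[OF h(1)] big_params_pos[OF h(2)]
    by (intro prod_convex_combination_ge) (auto simp: big_params_def)
  then show "s *\<^sub>R y + t *\<^sub>R z \<in> big_params \<omega>"
    using h st by (auto simp: big_params_def)
qed

theorem theorem1p2:
  fixes V :: "'v set" and M :: "'v set set" and F :: "'v \<Rightarrow> (real ^ 'n) set"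
  assumes "matroid_on V M"
    and "\<And>v. v \<in> V \<Longrightarrow> convex (F v)"
    and "\<And>V'. V' \<in> M \<Longrightarrow>
           \<exists>E. ellipsoid E \<and> measure lebesgue E = 1 \<and> E \<subseteq> (\<Inter>v\<in>V'. F v)"
  shows "\<exists>\<tau>. \<tau> \<subseteq> V \<and>
           real (matroid_rank M (V - \<tau>)) \<le> real CARD('n) * (real CARD('n) + 3) / 2 - 1 \<and>
           (\<exists>E. ellipsoid E \<and> measure lebesgue E = 1 \<and> E \<subseteq> (\<Inter>v\<in>\<tau>. F v))"
proof -
  obtain r :: "'n \<Rightarrow> nat" where r: "inj r"
    using finite_imp_inj_to_nat_seg[of "UNIV :: 'n set"] by auto
  define \<omega> where "\<omega> = measure lebesgue (cball 0 1 :: (real ^ 'n) set)"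
  have \<omega>: "0 < \<omega>" using content_cball_pos[of 1 "0 :: real ^ 'n"] by (simp add: \<omega>_def)
  define K where "K = (big_params \<omega> :: ((real ^ 'n uprod) \<times> (real ^ 'n)) set)"
  have "\<exists>z. z \<in> K \<and> param_ellipsoid r z \<subseteq> (\<Inter>v\<in>\<sigma>. F v)" if \<sigma>: "\<sigma> \<in> M" for \<sigma>
  proof -
    obtain E where E: "ellipsoid E" "measure lebesgue E = 1" "E \<subseteq> (\<Inter>v\<in>\<sigma>. F v)"
      using assms(3)[OF \<sigma>] by blast
    obtain z where z: "E = param_ellipsoid r z" "\<And>i. 0 < fst z $ Upair i i"
      using ellipsoid_param[OF r E(1)] by blast
    have "(\<Prod>i\<in>UNIV. fst z $ Upair i i) * \<omega> = 1"
      using measure_param_ellipsoid[OF r z(2)] E(2) z(1) by (simp add: \<omega>_def)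
    then have "z \<in> K"
      using z(2) \<omega> by (auto simp: K_def big_params_def field_simps less_imp_le)
    then show ?thesis using E z by blast
  qed
  then obtain Z where ZK: "\<And>\<sigma>. \<sigma> \<in> M \<Longrightarrow> Z \<sigma> \<in> K"
    and ZF: "\<And>\<sigma>. \<sigma> \<in> M \<Longrightarrow> param_ellipsoid r (Z \<sigma>) \<subseteq> (\<Inter>v\<in>\<sigma>. F v)"
    by metis
  \<comment> \<open>\<open>\<pi>\<close> collapses an ellipsoid to its centre.\<close>
  define \<pi> :: "(real ^ 'n uprod) \<times> (real ^ 'n) \<Rightarrow> (real ^ 'n uprod) \<times> (real ^ 'n)"
    where "\<pi> z = (0, snd z)" for z
  \<comment> \<open>\<open>F v\<close> need not be closed, so it is replaced by the polytope of parameters generated by the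
    chosen ellipsoids and their centres.\<close>
  define X where "X v = Z ` {\<sigma> \<in> M. v \<in> \<sigma>} \<union> \<pi> ` Z ` {\<sigma> \<in> M. v \<in> \<sigma>}" for v
  define G where "G v = convex hull (X v)" for v
  have fM: "finite M"
    using assms(1) finite_subset[of M "Pow V"] by (auto simp: matroid_on_def)
  have lin: "linear \<pi>" by (rule linearI) (auto simp: \<pi>_def)
  \<comment> \<open>\<open>\<pi>\<close> is idempotent, so it maps the generators \<open>X v\<close>
    into themselves; being linear, it commutes with the convex hull.\<close>
  have "\<pi> ` G v \<subseteq> G v" for v
    unfolding G_def convex_hull_linear_image[OF lin]
    by (rule hull_mono) (auto simp: X_def \<pi>_def)
  then have \<pi>G: "\<pi> x \<in> G v" if "x \<in> G v" for x v
    using that by blast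
  have \<pi>sub: "param_ellipsoid r (\<pi> z) \<subseteq> param_ellipsoid r z" for z
  proof -
    have "triangular_matrix r (fst z) *v 0 + snd z \<in> param_ellipsoid r z"
      unfolding param_ellipsoid_def by (rule imageI) simp
    then show ?thesis
      by (auto simp: param_ellipsoid_def[of r "(0, snd z)"] \<pi>_def linear_0[OF linear_triangular_matrix])
  qed
  have GF: "param_ellipsoid r z \<subseteq> F v" if v: "v \<in> V" and z: "z \<in> G v" for v z
  proof -
    have "X v \<subseteq> {z. param_ellipsoid r z \<subseteq> F v}"
    proof -
      have "param_ellipsoid r (Z \<sigma>) \<subseteq> F v" if "\<sigma> \<in> M" "v \<in> \<sigma>" for \<sigma>
        using ZF[OF that(1)] that(2) by blast
      moreover from this have "param_ellipsoid r (\<pi> (Z \<sigma>)) \<subseteq> F v" if "\<sigma> \<in> M" "v \<in> \<sigma>" for \<sigma>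
        using \<pi>sub that by (meson order_trans)
      ultimately show ?thesis unfolding X_def by blast
    qed
    then have "G v \<subseteq> {z. param_ellipsoid r z \<subseteq> F v}"
      unfolding G_def
      by (intro hull_minimal convex_param_ellipsoid_subset assms(2) v)
    then show ?thesis using z by blast
  qed
  obtain \<tau> where \<tau>: "\<tau> \<subseteq> V"
    and rank: "matroid_rank M (V - \<tau>) < DIM((real ^ 'n uprod) \<times> (real ^ 'n))"
    and K\<tau>: "K \<inter> (\<Inter>v\<in>\<tau>. G v) \<noteq> {}"
  proof (rule matroid_convex_intersection[OF assms(1), of G K \<pi>])
    show "convex K" "closed K"
      using convex_big_params[OF \<omega>] closed_big_params by (auto simp: K_def)
    show "convex (G v)" "closed (G v)" for v
      using fM by (auto simp: G_def X_def intro!: compact_imp_closed finite_imp_compact_convex_hull)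
    show "K \<inter> (\<Inter>v\<in>\<sigma>. G v) \<noteq> {}" if "\<sigma> \<in> M" for \<sigma>
    proof -
      have "Z \<sigma> \<in> (\<Inter>v\<in>\<sigma>. G v)"
        using that by (auto simp: G_def X_def intro!: hull_inc)
      then show ?thesis using ZK that by blast
    qed
    show "norm (\<pi> z) < norm z" if "z \<in> K" for z
    proof -
      \<comment> \<open>The diagonal is positive on \<open>K\<close>, so discarding the triangular
        part strictly lowers the norm.\<close>
      have "fst z \<noteq> 0"
        using big_params_pos[of z \<omega>] that \<omega> by (auto simp: K_def)
      then show ?thesis
        by (simp add: \<pi>_def norm_prod_def real_less_rsqrt)
    qed
  qed (use \<pi>G in auto)
  obtain z where z: "z \<in> K" "\<And>v. v \<in> \<tau> \<Longrightarrow> z \<in> G v" using K\<tau> by blast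
  define A where "A = triangular_matrix r (fst z)"
  have detA: "det A = (\<Prod>i\<in>UNIV. fst z $ Upair i i)"
    unfolding A_def by (rule det_triangular_matrix[OF r])
  have pos: "0 < det A"
    unfolding detA using big_params_pos[of z \<omega>] z \<omega> by (intro prod_pos) (auto simp: K_def)
  have "1 \<le> \<bar>det A\<bar> * \<omega>"
    using z(1) \<omega> pos by (simp add: K_def big_params_def detA field_simps)
  \<comment> \<open>\<open>K\<close> only ensures volume at least one; shrinking makes it exactly
    one without leaving the ellipsoid.\<close>
  then obtain E where E: "ellipsoid E" "measure lebesgue E = 1" "E \<subseteq> param_ellipsoid r z"
    using unit_volume_ellipsoid_in_affine_image[of A "snd z"] pos
    by (auto simp: \<omega>_def A_def param_ellipsoid_def)
  moreover have "param_ellipsoid r z \<subseteq> (\<Inter>v\<in>\<tau>. F v)"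
    using GF z \<tau> by blast
  moreover have "real (matroid_rank M (V - \<tau>)) \<le> real CARD('n) * (real CARD('n) + 3) / 2 - 1"
  proof -
    let ?d = "CARD('n)"
    \<comment> \<open>The dimension is d(d+1)/2 + d = d(d+3)/2, and the strict inequality in
      \<open>rank\<close> supplies the final -1.\<close>
    have "matroid_rank M (V - \<tau>) + 1 \<le> ?d * (?d + 1) div 2 + ?d"
      using rank by (simp add: card_UNIV_uprod)
    then have "real (matroid_rank M (V - \<tau>)) + 1 \<le> real (?d * (?d + 1) div 2) + real ?d"
      by linarith
    also have "real (?d * (?d + 1) div 2) = real ?d * (real ?d + 1) / 2"
      by (subst real_of_nat_div) (auto simp: algebra_simps)
    finally show ?thesis by (simp add: field_simps)
  qed
  ultimately show ?thesis using \<tau> by blast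
qed

end
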